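(* Let $T_{a,w}$ be a weighted translation operator on $L^p(G)$, $1\le p<\infty$, and let $y$ be a distributionally irregular vector of $T_{a,w}$. Let $$[y]:=\{z\in L^p(G): c_1|z|\le|y|\le c_2|z|\text{ for some constants }c_1,c_2>0\text{ depending only on }y,z\}.$$ Then: (i) all vectors in $[y]$ are distributionally irregular vectors of $T_{a,w}$; (ii) $[y]$ is path connected; (iii) $[y]$ is dense in the closed subspace $L^p(\{y\ne0\})$, i.e. $\overline{[y]}=L^p(\{y\neq0\})$. In particular, the set $DIV\cap L^p(\{y\ne0\})$ is connected, where $\{y\neq0\}:=\{x\in G:y(x)\ne0\}$.
   Context: $G$ is a second countable locally compact Hausdorff group with a right invariant Haar measure $\lambda$; $L^p(G)$ is the complex Lebesgue space with respect to $\lambda$ (inequalities between its elements hold almost everywhere). For measurable $Y\subseteq G$, $L^p(Y)$ is identified with the closed subspace of $L^p(G)$ of functions vanishing a.e. outside $Y$. A weight on $G$ is a bounded continuous function $w:G\to(0,\infty)$. For $a\in G$, $(T_af)(x):=f(xa^{-1})$ and the weighted translation is $T_{a,w}f:=w\,T_af$ for $f\in L^p(G)$. For $A\subset\mathbb{N}=\{1,2,\dots\}$, $\overline{\mathrm{dens}}(A)=\limsup_{n\to\infty}\frac{\mathrm{card}(A\cap[1,n])}{n}$; $\lim_{n\in A}$ means the limit as $n\to\infty$ with $n\in A$. A vector $x$ is distributionally irregular for an operator $T$ on a Banach space if there exist $A,B\subset\mathbb{N}$ with $\overline{\mathrm{dens}}(A)=\overline{\mathrm{dens}}(B)=1$ such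 that $\lim_{n\in A}T^nx=0$ and $\lim_{n\in B}\|T^nx\|=\infty$. $DIV$ denotes the set of all distributionally irregular vectors of $T_{a,w}$. Topological notions refer to the norm topology. *)

theory Defs
  imports "HOL-Analysis.Analysis"
begin

text \<open>
  A topological group that need not be commutative is an instance of the class
  \<open>topological_group_add\<close>.  The group operation is thus written additively: the product \<open>x y\<close> of
  two elements appears as \<open>x + y\<close>, and \<open>x a\<^sup>-\<^sup>1\<close> as \<open>x - a\<close>, which is
  \<open>x + (- a)\<close>.  No commutativity is assumed.
\<close>

definition right_Haar_measure :: "'a::topological_group_add measure \<Rightarrow> bool" where
  "right_Haar_measure M \<longleftrightarrow>
     sets M = sets borel \<and>
     emeasure M (space M) \<noteq> 0 \<and>
     (\<forall>K. compact K \<longrightarrow> emeasure M K < \<infinity>) \<and>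
     (\<forall>A\<in>sets borel. emeasure M A = (INF U\<in>{U. open U \<and> A \<subseteq> U}. emeasure M U)) \<and>
     (\<forall>U. open U \<longrightarrow> emeasure M U = (SUP K\<in>{K. compact K \<and> K \<subseteq> U}. emeasure M K)) \<and>
     (\<forall>A\<in>sets borel. \<forall>a. emeasure M ((\<lambda>x. x + a) ` A) = emeasure M A)"


subsection \<open>The complex Lebesgue space\<close>

text \<open>
  The elements of \<open>Lp_space M p\<close> are classes of \<open>p\<close>-integrable functions modulo equality almost
  everywhere; \<open>Lp_fun M p\<close> and \<open>Lp_seminorm M p\<close> are the corresponding notions for functions.
\<close>

definition Lp_fun :: "'a measure \<Rightarrow> real \<Rightarrow> ('a \<Rightarrow> complex) set" where
  "Lp_fun M p = {f \<in> borel_measurable M. integrable M (\<lambda>x. norm (f x) powr p)}"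

definition Lp_seminorm :: "'a measure \<Rightarrow> real \<Rightarrow> ('a \<Rightarrow> complex) \<Rightarrow> real" where
  "Lp_seminorm M p f = (LINT x|M. norm (f x) powr p) powr (1 / p)"

definition Lp_eq :: "'a measure \<Rightarrow> real \<Rightarrow> (('a \<Rightarrow> complex) \<times> ('a \<Rightarrow> complex)) set" where
  "Lp_eq M p = {(f, g). f \<in> Lp_fun M p \<and> g \<in> Lp_fun M p \<and> (AE x in M. f x = g x)}"

definition Lp_space :: "'a measure \<Rightarrow> real \<Rightarrow> ('a \<Rightarrow> complex) set set" where
  "Lp_space M p = Lp_fun M p // Lp_eq M p"

definition Lp_class :: "'a measure \<Rightarrow> real \<Rightarrow> ('a \<Rightarrow> complex) \<Rightarrow> ('a \<Rightarrow> complex) set" where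
  "Lp_class M p f = Lp_eq M p `` {f}"

definition Lp_rep :: "('a \<Rightarrow> complex) set \<Rightarrow> 'a \<Rightarrow> complex" where
  "Lp_rep c = (SOME f. f \<in> c)"

definition Lp_norm :: "'a measure \<Rightarrow> real \<Rightarrow> ('a \<Rightarrow> complex) set \<Rightarrow> real" where
  "Lp_norm M p c = Lp_seminorm M p (Lp_rep c)"

definition Lp_dist ::
  "'a measure \<Rightarrow> real \<Rightarrow> ('a \<Rightarrow> complex) set \<Rightarrow> ('a \<Rightarrow> complex) set \<Rightarrow> real" where
  "Lp_dist M p c d = Lp_seminorm M p (\<lambda>x. Lp_rep c x - Lp_rep d x)"

definition Lp_topology :: "'a measure \<Rightarrow> real \<Rightarrow> ('a \<Rightarrow> complex) set topology" where
  "Lp_topology M p = Metric_space.mtopology (Lp_space M p) (Lp_dist M p)"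

definition Lp_on :: "'a measure \<Rightarrow> real \<Rightarrow> 'a set \<Rightarrow> ('a \<Rightarrow> complex) set set" where
  "Lp_on M p Y = {Lp_class M p f | f. f \<in> Lp_fun M p \<and> (AE x in M. x \<notin> Y \<longrightarrow> f x = 0)}"


subsection \<open>Weighted translations and distributional irregularity\<close>

definition weight :: "('a::topological_space \<Rightarrow> real) \<Rightarrow> bool" where
  "weight w \<longleftrightarrow> continuous_on UNIV w \<and> bounded (range w) \<and> (\<forall>x. w x > 0)"

definition wtrans :: "'a::group_add \<Rightarrow> ('a \<Rightarrow> real) \<Rightarrow> ('a \<Rightarrow> complex) \<Rightarrow> 'a \<Rightarrow> complex" where
  "wtrans a w f = (\<lambda>x. of_real (w x) * f (x - a))"

definition Lp_wtrans ::
  "'a::group_add measure \<Rightarrow> real \<Rightarrow> 'a \<Rightarrow> ('a \<Rightarrow> real) \<Rightarrow> ('a \<Rightarrow> complex) set \<Rightarrow> ('a \<Rightarrow> complex) set"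
where
  "Lp_wtrans M p a w c = Lp_class M p (wtrans a w (Lp_rep c))"

definition upper_density :: "nat set \<Rightarrow> ereal" where
  "upper_density A = limsup (\<lambda>n. ereal (real (card (A \<inter> {1..n})) / real n))"

definition distributionally_irregular ::
  "'a measure \<Rightarrow> real \<Rightarrow> (('a \<Rightarrow> complex) set \<Rightarrow> ('a \<Rightarrow> complex) set) \<Rightarrow> ('a \<Rightarrow> complex) set \<Rightarrow> bool"
where
  "distributionally_irregular M p T c \<longleftrightarrow>
     (\<exists>A B. A \<subseteq> {1..} \<and> B \<subseteq> {1..} \<and> upper_density A = 1 \<and> upper_density B = 1 \<and>
        limitin (Lp_topology M p) (\<lambda>n. (T ^^ n) c) (Lp_class M p (\<lambda>x. 0))
          (inf sequentially (principal A)) \<and>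
        filterlim (\<lambda>n. Lp_norm M p ((T ^^ n) c)) at_top (inf sequentially (principal B)))"

definition DIV ::
  "'a::group_add measure \<Rightarrow> real \<Rightarrow> 'a \<Rightarrow> ('a \<Rightarrow> real) \<Rightarrow> ('a \<Rightarrow> complex) set set" where
  "DIV M p a w = {c \<in> Lp_space M p. distributionally_irregular M p (Lp_wtrans M p a w) c}"

text \<open>The set \<open>[y]\<close>, for a function \<open>y\<close> representing an element of the Lebesgue space.\<close>

definition Lp_comparable :: "'a measure \<Rightarrow> real \<Rightarrow> ('a \<Rightarrow> complex) \<Rightarrow> ('a \<Rightarrow> complex) set set" where
  "Lp_comparable M p y =
     {Lp_class M p z | z. z \<in> Lp_fun M p \<and>
        (\<exists>c1>0. \<exists>c2>0. AE x in M. c1 * norm (z x) \<le> norm (y x) \<and> norm (y x) \<le> c2 * norm (z x))}"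


subsection \<open>Independence of representatives\<close>

lemma equiv_Lp_eq: "equiv (Lp_fun M p) (Lp_eq M p)"
proof (rule equivI)
  show "Lp_eq M p \<subseteq> Lp_fun M p \<times> Lp_fun M p"
    by (auto simp: Lp_eq_def)
  show "refl_on (Lp_fun M p) (Lp_eq M p)"
    by (auto simp: refl_on_def Lp_eq_def)
  show "sym (Lp_eq M p)"
    unfolding sym_def Lp_eq_def by (auto elim: eventually_mono)
  show "trans (Lp_eq M p)"
    unfolding trans_def Lp_eq_def by (auto elim: eventually_elim2)
qed

lemma Lp_space_eq_image: "Lp_space M p = Lp_class M p ` Lp_fun M p"
  by (auto simp: Lp_space_def Lp_class_def quotient_def)

lemma Lp_class_eq_iff:
  assumes "f \<in> Lp_fun M p" "g \<in> Lp_fun M p"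
  shows "Lp_class M p f = Lp_class M p g \<longleftrightarrow> (AE x in M. f x = g x)"
  using eq_equiv_class_iff[OF equiv_Lp_eq assms] assms
  by (simp add: Lp_class_def Lp_eq_def)

lemma Lp_rep_class:
  assumes "f \<in> Lp_fun M p"
  shows "Lp_rep (Lp_class M p f) \<in> Lp_fun M p" "AE x in M. Lp_rep (Lp_class M p f) x = f x"
proof -
  have "f \<in> Lp_class M p f"
    using assms by (simp add: Lp_class_def Lp_eq_def)
  then have "Lp_rep (Lp_class M p f) \<in> Lp_class M p f"
    unfolding Lp_rep_def by (rule someI[of "\<lambda>g. g \<in> Lp_class M p f"])
  moreover have "g \<in> Lp_fun M p \<and> (AE x in M. f x = g x)" if "g \<in> Lp_class M p f" for g
    using that by (simp add: Lp_class_def Lp_eq_def)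
  ultimately have "Lp_rep (Lp_class M p f) \<in> Lp_fun M p \<and> (AE x in M. f x = Lp_rep (Lp_class M p f) x)"
    by blast
  then show "Lp_rep (Lp_class M p f) \<in> Lp_fun M p" "AE x in M. Lp_rep (Lp_class M p f) x = f x"
    by (auto elim: eventually_mono)
qed

lemma Lp_class_rep:
  assumes "c \<in> Lp_space M p"
  shows "Lp_rep c \<in> Lp_fun M p" "Lp_class M p (Lp_rep c) = c"
proof -
  obtain f where f: "f \<in> Lp_fun M p" "c = Lp_class M p f"
    using assms by (auto simp: Lp_space_eq_image)
  then show "Lp_rep c \<in> Lp_fun M p" "Lp_class M p (Lp_rep c) = c"
    using Lp_rep_class[OF f(1)] by (auto simp: Lp_class_eq_iff)
qed

lemma Lp_seminorm_cong_AE: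
  assumes "f \<in> borel_measurable M" "g \<in> borel_measurable M" "AE x in M. f x = g x"
  shows "Lp_seminorm M p f = Lp_seminorm M p g"
proof -
  have "(LINT x|M. norm (f x) powr p) = (LINT x|M. norm (g x) powr p)"
    using assms by (intro integral_cong_AE) (auto elim: eventually_mono)
  then show ?thesis
    by (simp add: Lp_seminorm_def)
qed

lemma Lp_norm_class:
  assumes "f \<in> Lp_fun M p"
  shows "Lp_norm M p (Lp_class M p f) = Lp_seminorm M p f"
  unfolding Lp_norm_def
  using Lp_rep_class[OF assms] assms by (intro Lp_seminorm_cong_AE) (auto simp: Lp_fun_def)

lemma Lp_dist_class:
  assumes "f \<in> Lp_fun M p" "g \<in> Lp_fun M p"
  shows "Lp_dist M p (Lp_class M p f) (Lp_class M p g) = Lp_seminorm M p (\<lambda>x. f x - g x)"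
proof -
  have [measurable]: "f \<in> borel_measurable M" "g \<in> borel_measurable M"
    "Lp_rep (Lp_class M p f) \<in> borel_measurable M" "Lp_rep (Lp_class M p g) \<in> borel_measurable M"
    using assms Lp_rep_class(1)[of f M p] Lp_rep_class(1)[of g M p] by (auto simp: Lp_fun_def)
  show ?thesis
    unfolding Lp_dist_def
    using Lp_rep_class(2)[OF assms(1)] Lp_rep_class(2)[OF assms(2)]
    by (intro Lp_seminorm_cong_AE) (auto elim: eventually_elim2)
qed


subsection \<open>The Lebesgue space is a metric space\<close>

lemma powr_convex_comb:
  fixes x y s p :: real
  assumes p: "1 \<le> p" and nn: "0 \<le> x" "0 \<le> y" "0 < s" "s < 1"
  shows "((1 - s) * x + s * y) powr p \<le> (1 - s) * x powr p + s * y powr p"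
proof -
  have shrink: "(t * u) powr p \<le> t * u powr p" if "0 < t" "t < 1" "0 \<le> u" for t u :: real
  proof -
    have "t powr p \<le> t powr 1"
      using that p by (intro powr_mono') auto
    then show ?thesis
      using that by (simp add: powr_mult mult_right_mono)
  qed
  consider "x = 0" | "y = 0" | "0 < x" "0 < y"
    using nn by linarith
  then show ?thesis
  proof cases
    case 1
    then show ?thesis using shrink[of s y] nn p by simp
  next
    case 2
    then show ?thesis using shrink[of "1 - s" x] nn p by simp
  next
    case 3
    then show ?thesis
      using convex_onD[OF powr_convex[OF p], of s x y] nn by simp
  qed
qed

lemma Lp_seminorm_nonneg: "0 \<le> Lp_seminorm M p f"
  by (simp add: Lp_seminorm_def)

lemma Lp_seminorm_powr:
  assumes "1 \<le> p"
  shows "Lp_seminorm M p f powr p = (LINT x|M. norm (f x) powr p)"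
proof -
  have "0 \<le> (LINT x|M. norm (f x) powr p)"
    by (intro integral_nonneg_AE) auto
  then show ?thesis
    using assms by (simp add: Lp_seminorm_def powr_powr)
qed

lemma Lp_seminorm_eq_0_iff:
  assumes "1 \<le> p" "f \<in> Lp_fun M p"
  shows "Lp_seminorm M p f = 0 \<longleftrightarrow> (AE x in M. f x = 0)"
proof -
  have "(LINT x|M. norm (f x) powr p) = 0 \<longleftrightarrow> (AE x in M. norm (f x) powr p = 0)"
    using assms by (intro integral_nonneg_eq_0_iff_AE) (auto simp: Lp_fun_def)
  then show ?thesis
    by (simp add: Lp_seminorm_def)
qed

lemma Lp_minkowski:
  assumes p: "1 \<le> p" and f: "f \<in> Lp_fun M p" and g: "g \<in> Lp_fun M p"
  shows "(\<lambda>x. f x + g x) \<in> Lp_fun M p"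
    and "Lp_seminorm M p (\<lambda>x. f x + g x) \<le> Lp_seminorm M p f + Lp_seminorm M p g"
proof -
  have [measurable]: "f \<in> borel_measurable M" "g \<in> borel_measurable M"
    and int: "integrable M (\<lambda>x. norm (f x) powr p)" "integrable M (\<lambda>x. norm (g x) powr p)"
    using f g by (auto simp: Lp_fun_def)
  have key: "norm (f x + g x) powr p \<le>
      (s + t) powr p * (s / (s + t) * (norm (f x) / s) powr p + t / (s + t) * (norm (g x) / t) powr p)"
    if st: "0 < s" "0 < t" for s t x
  proof -
    have e: "1 - t / (s + t) = s / (s + t)"
      using st by (simp add: field_simps)
    have "norm (f x + g x) powr p \<le> (norm (f x) + norm (g x)) powr p"
      using p by (intro powr_mono2) (auto intro: norm_triangle_ineq)
    also have "norm (f x) + norm (g x) =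
        (s + t) * ((1 - t / (s + t)) * (norm (f x) / s) + t / (s + t) * (norm (g x) / t))"
    proof -
      have "(s + t) * (s / (s + t) * (norm (f x) / s)) = norm (f x)"
        "(s + t) * (t / (s + t) * (norm (g x) / t)) = norm (g x)"
        using st by simp_all
      then show ?thesis
        unfolding e distrib_left by simp
    qed
    also have "\<dots> powr p = (s + t) powr p *
        ((1 - t / (s + t)) * (norm (f x) / s) + t / (s + t) * (norm (g x) / t)) powr p"
      using st by (intro powr_mult; simp add: e)
    also have "\<dots> \<le> (s + t) powr p *
        ((1 - t / (s + t)) * (norm (f x) / s) powr p + t / (s + t) * (norm (g x) / t) powr p)"
      using st p by (intro mult_left_mono powr_convex_comb) auto
    finally show ?thesis
      by (simp add: e)
  qed
  have pd: "(norm (h x) / s) powr p = norm (h x) powr p / s powr p"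
    if "0 < s" for h :: "'a \<Rightarrow> complex" and s x
    using that by (simp add: powr_divide)
  have intst: "integrable M (\<lambda>x. (s + t) powr p *
      (s / (s + t) * (norm (f x) / s) powr p + t / (s + t) * (norm (g x) / t) powr p))"
    if "0 < s" "0 < t" for s t
    using int that by (simp add: pd)
  have "integrable M (\<lambda>x. norm (f x + g x) powr p)"
    by (rule Bochner_Integration.integrable_bound[OF intst[of 1 1]])
      (use key[of 1 1] in \<open>auto intro!: order_trans[OF _ abs_ge_self]\<close>)
  then show fg: "(\<lambda>x. f x + g x) \<in> Lp_fun M p"
    by (simp add: Lp_fun_def)
  define s where "s = Lp_seminorm M p f"
  define t where "t = Lp_seminorm M p g"
  consider "s = 0" | "t = 0" | "0 < s" "0 < t"
    using Lp_seminorm_nonneg[of M p f] Lp_seminorm_nonneg[of M p g] unfolding s_def t_def by linarith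
  then show "Lp_seminorm M p (\<lambda>x. f x + g x) \<le> Lp_seminorm M p f + Lp_seminorm M p g"
  proof cases
    case 1
    then have "AE x in M. f x = 0"
      using p f by (simp add: s_def Lp_seminorm_eq_0_iff)
    then have "Lp_seminorm M p (\<lambda>x. f x + g x) = Lp_seminorm M p g"
      by (intro Lp_seminorm_cong_AE) (auto elim: eventually_mono)
    then show ?thesis
      using Lp_seminorm_nonneg[of M p f] by simp
  next
    case 2
    then have "AE x in M. g x = 0"
      using p g by (simp add: t_def Lp_seminorm_eq_0_iff)
    then have "Lp_seminorm M p (\<lambda>x. f x + g x) = Lp_seminorm M p f"
      by (intro Lp_seminorm_cong_AE) (auto elim: eventually_mono)
    then show ?thesis
      using Lp_seminorm_nonneg[of M p g] by simp
  next
    case 3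
    have F: "(LINT x|M. norm (f x) powr p) = s powr p" "(LINT x|M. norm (g x) powr p) = t powr p"
      using p by (simp_all add: s_def t_def Lp_seminorm_powr)
    have st1: "s / (s + t) + t / (s + t) = 1"
      using 3 by (simp flip: add_divide_distrib)
    have "(LINT x|M. norm (f x + g x) powr p) \<le> (LINT x|M. (s + t) powr p *
      (s / (s + t) * (norm (f x) / s) powr p + t / (s + t) * (norm (g x) / t) powr p))"
      using fg key[OF 3] intst[OF 3] by (intro integral_mono) (auto simp: Lp_fun_def)
    also have "\<dots> = (s + t) powr p * (s / (s + t) + t / (s + t))"
      using int 3 by (simp add: pd F)
    also have "\<dots> = (s + t) powr p"
      by (simp add: st1)
    finally have "Lp_seminorm M p (\<lambda>x. f x + g x) powr p \<le> (s + t) powr p"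
      using p by (simp add: Lp_seminorm_powr)
    then have "Lp_seminorm M p (\<lambda>x. f x + g x) \<le> s + t"
      using p 3 by (meson add_pos_pos less_le_not_le linorder_le_less_linear powr_less_mono2
          order_less_le_trans zero_less_one)
    then show ?thesis
      by (simp add: s_def t_def)
  qed
qed

lemma Lp_seminorm_minus: "Lp_seminorm M p (\<lambda>x. f x - g x) = Lp_seminorm M p (\<lambda>x. g x - f x)"
  by (simp add: Lp_seminorm_def norm_minus_commute)

lemma Lp_fun_diff:
  assumes "1 \<le> p" "f \<in> Lp_fun M p" "g \<in> Lp_fun M p"
  shows "(\<lambda>x. f x - g x) \<in> Lp_fun M p"
proof -
  have "(\<lambda>x. - g x) \<in> Lp_fun M p"
    using assms(3) by (simp add: Lp_fun_def)
  from Lp_minkowski(1)[OF assms(1,2) this] show ?thesis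
    by simp
qed

lemma Metric_space_Lp:
  assumes p: "1 \<le> p"
  shows "Metric_space (Lp_space M p) (Lp_dist M p)"
proof
  fix c d e
  show "0 \<le> Lp_dist M p c d"
    by (simp add: Lp_dist_def Lp_seminorm_nonneg)
  show "Lp_dist M p c d = Lp_dist M p d c"
    unfolding Lp_dist_def by (rule Lp_seminorm_minus)
  assume c: "c \<in> Lp_space M p" and d: "d \<in> Lp_space M p"
  note cd = Lp_class_rep[OF c] Lp_class_rep[OF d]
  show "Lp_dist M p c d = 0 \<longleftrightarrow> c = d"
    using Lp_class_eq_iff[OF cd(1) cd(3)] cd p
    by (simp add: Lp_dist_def Lp_seminorm_eq_0_iff Lp_fun_diff)
  assume e: "e \<in> Lp_space M p"
  show "Lp_dist M p c e \<le> Lp_dist M p c d + Lp_dist M p d e"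
    using Lp_minkowski(2)[OF p Lp_fun_diff[OF p cd(1) cd(3)]
        Lp_fun_diff[OF p cd(3) Lp_class_rep(1)[OF e]]]
    by (simp add: Lp_dist_def)
qed


subsection \<open>Weighted translations act on the Lebesgue space\<close>

lemma measurable_diff_right:
  fixes M :: "'a::topological_group_add measure"
  assumes "right_Haar_measure M"
  shows "(\<lambda>x. x - a) \<in> measurable M M"
proof -
  have "(\<lambda>x::'a. x - a) \<in> borel_measurable borel"
    by (intro borel_measurable_continuous_onI continuous_intros)
  then show ?thesis
    using assms measurable_cong_sets[of M borel M borel] by (simp add: right_Haar_measure_def)
qed

lemma distr_diff_right:
  fixes M :: "'a::topological_group_add measure"
  assumes "right_Haar_measure M"
  shows "distr M M (\<lambda>x. x - a) = M"
proof (rule measure_eqI)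
  have space: "space M = UNIV"
    using assms sets_eq_imp_space_eq[of M borel] by (simp add: right_Haar_measure_def)
  fix A assume "A \<in> sets (distr M M (\<lambda>x. x - a))"
  then have A: "A \<in> sets M"
    by simp
  have "(\<lambda>x. x - a) -` A = (\<lambda>x. x + a) ` A"
    by (auto simp: image_iff intro!: bexI[of _ "_ - a"])
  then have "emeasure (distr M M (\<lambda>x. x - a)) A = emeasure M ((\<lambda>x. x + a) ` A)"
    using A measurable_diff_right[OF assms, of a] by (simp add: emeasure_distr space)
  also have "\<dots> = emeasure M A"
    using assms A by (auto simp: right_Haar_measure_def)
  finally show "emeasure (distr M M (\<lambda>x. x - a)) A = emeasure M A" .
qed simp

lemma wtrans_Lp_fun:
  fixes M :: "'a::topological_group_add measure"
  assumes H: "right_Haar_measure M" and w: "weight w" and p: "1 \<le> p" and f: "f \<in> Lp_fun M p"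
  shows "wtrans a w f \<in> Lp_fun M p"
proof -
  note [measurable] = measurable_diff_right[OF H, of a]
  have [measurable]: "f \<in> borel_measurable M"
    and int: "integrable M (\<lambda>x. norm (f x) powr p)"
    using f by (auto simp: Lp_fun_def)
  have "w \<in> borel_measurable borel"
    using w by (intro borel_measurable_continuous_onI) (simp add: weight_def)
  then have [measurable]: "w \<in> borel_measurable M"
    using H measurable_cong_sets[of M borel "borel :: real measure" borel]
    by (simp add: right_Haar_measure_def)
  obtain b where b: "\<And>x. \<bar>w x\<bar> \<le> b"
    using w by (auto simp: weight_def bounded_iff)
  have "integrable (distr M M (\<lambda>x. x - a)) (\<lambda>x. norm (f x) powr p)"
    using int by (simp add: distr_diff_right[OF H])
  then have "integrable M (\<lambda>x. norm (f (x - a)) powr p)"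
    by (subst (asm) integrable_distr_eq) auto
  then have "integrable M (\<lambda>x. b powr p * norm (f (x - a)) powr p)"
    by simp
  then have "integrable M (\<lambda>x. norm (wtrans a w f x) powr p)"
  proof (rule Bochner_Integration.integrable_bound)
    show "(\<lambda>x. norm (wtrans a w f x) powr p) \<in> borel_measurable M"
      unfolding wtrans_def by measurable
    have "norm (wtrans a w f x) powr p \<le> b powr p * norm (f (x - a)) powr p" for x
      using b[of x] p by (simp add: wtrans_def norm_mult powr_mult mult_right_mono powr_mono2)
    then show "AE x in M. norm (norm (wtrans a w f x) powr p)
        \<le> norm (b powr p * norm (f (x - a)) powr p)"
      by simp
  qed
  then show ?thesis
    unfolding Lp_fun_def wtrans_def by simp
qed

lemma Lp_wtrans_class:
  fixes M :: "'a::topological_group_add measure"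
  assumes H: "right_Haar_measure M" and w: "weight w" and p: "1 \<le> p" and f: "f \<in> Lp_fun M p"
  shows "Lp_wtrans M p a w (Lp_class M p f) = Lp_class M p (wtrans a w f)"
proof -
  note g = Lp_rep_class[OF f]
  have "AE x in distr M M (\<lambda>x. x - a). Lp_rep (Lp_class M p f) x = f x"
    unfolding distr_diff_right[OF H] by (rule g(2))
  then have "AE x in M. Lp_rep (Lp_class M p f) (x - a) = f (x - a)"
    using measurable_diff_right[OF H] by (rule AE_distrD[rotated])
  then show ?thesis
    unfolding Lp_wtrans_def
    using Lp_class_eq_iff[OF wtrans_Lp_fun[OF H w p g(1)] wtrans_Lp_fun[OF H w p f], of a a]
    by (auto simp: wtrans_def elim: eventually_mono)
qed

end

theory Submission
  imports Defs
begin

text \<open>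
  The operator multiplies by a positive weight after a measure-preserving translation, so it respects
  pointwise domination: \<open>|z| \<le> C |y|\<close> almost everywhere gives \<open>|T\<^sup>n z| \<le> C |T\<^sup>n y|\<close> almost everywhere
  for every \<open>n\<close>, with the same constant (\<open>dominated_wtrans_iterate\<close>).  For \<open>z\<close> in \<open>[y]\<close> the two
  sequences of norms along the orbits of \<open>z\<close> and \<open>y\<close> therefore bound each other up to constants, and
  the sets \<open>A\<close> and \<open>B\<close> that witness distributional irregularity of \<open>y\<close> also serve \<open>z\<close>
  (\<open>distributionally_irregular_comparable\<close>).

  Path connectedness needs care only because a segment between two members of \<open>[y]\<close> may pass through
  \<open>0\<close>, as from \<open>y\<close> to \<open>-y\<close>.  This cannot happen when the two values form, at each point, an
  angle of at most a right angle, for then the modulus along the segment is at least half the smaller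
  of the two moduli (\<open>norm_segment_ge\<close>).  Every \<open>z\<close> reaches the function \<open>|y|\<close> by two such
  segments: first to \<open>i |y|\<close> where \<open>z\<close> has nonnegative imaginary part and to \<open>-i |y|\<close> elsewhere, and
  from there to \<open>|y|\<close>.

  For density, a function \<open>f\<close> vanishing where \<open>y\<close> does is approximated by keeping \<open>f\<close> where
  \<open>|y| / n \<le> |f| \<le> n |y|\<close> and putting \<open>y / n\<close> elsewhere; dominated convergence applies, with bound
  \<open>|f| + |y|\<close>.  Finally \<open>DIV \<inter> L\<^sup>p({y \<noteq> 0})\<close> lies between the connected set \<open>[y]\<close> and
  its closure, hence is connected.
\<close>


section \<open>Domination and the seminorm\<close>

lemma Lp_seminorm_scale:
  assumes "1 \<le> p"
  shows "Lp_seminorm M p (\<lambda>x. of_real r * f x) = \<bar>r\<bar> * Lp_seminorm M p f"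
proof -
  have "0 \<le> (LINT x|M. norm (f x) powr p)"
    by (intro integral_nonneg_AE) auto
  with assms show ?thesis
    by (simp add: Lp_seminorm_def norm_mult powr_mult powr_powr)
qed

lemma Lp_fun_scale:
  assumes "f \<in> Lp_fun M p"
  shows "(\<lambda>x. of_real r * f x) \<in> Lp_fun M p"
proof -
  have [measurable]: "f \<in> borel_measurable M"
    using assms by (simp add: Lp_fun_def)
  have "(\<lambda>x. of_real r * f x) \<in> borel_measurable M"
    by measurable
  with assms show ?thesis
    by (simp add: Lp_fun_def norm_mult powr_mult)
qed

lemma Lp_fun_norm:
  assumes "f \<in> Lp_fun M p"
  shows "(\<lambda>x. of_real (norm (f x))) \<in> Lp_fun M p"
proof -
  have [measurable]: "f \<in> borel_measurable M"
    using assms by (simp add: Lp_fun_def)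
  have "(\<lambda>x. complex_of_real (norm (f x))) \<in> borel_measurable M"
    by measurable
  with assms show ?thesis
    by (simp add: Lp_fun_def)
qed

lemma Lp_fun_dominated:
  assumes p: "1 \<le> p" and g: "g \<in> Lp_fun M p" and f [measurable]: "f \<in> borel_measurable M"
    and dom: "AE x in M. norm (f x) \<le> norm (g x)"
  shows "f \<in> Lp_fun M p"
proof -
  have "integrable M (\<lambda>x. norm (f x) powr p)"
  proof (rule Bochner_Integration.integrable_bound)
    show "integrable M (\<lambda>x. norm (g x) powr p)"
      using g by (simp add: Lp_fun_def)
    show "AE x in M. norm (norm (f x) powr p) \<le> norm (norm (g x) powr p)"
      using dom p by (auto elim!: eventually_mono intro: powr_mono2)
  qed simp
  then show ?thesis
    by (simp add: Lp_fun_def)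
qed

lemma Lp_seminorm_mono:
  assumes p: "1 \<le> p" and g: "g \<in> Lp_fun M p" and f: "f \<in> borel_measurable M"
    and dom: "AE x in M. norm (f x) \<le> norm (g x)"
  shows "Lp_seminorm M p f \<le> Lp_seminorm M p g"
proof -
  have "(LINT x|M. norm (f x) powr p) \<le> (LINT x|M. norm (g x) powr p)"
    using Lp_fun_dominated[OF assms] g dom p
    by (intro integral_mono_AE) (auto simp: Lp_fun_def elim!: eventually_mono intro: powr_mono2)
  then show ?thesis
    unfolding Lp_seminorm_def using p
    by (intro powr_mono2) (auto intro: integral_nonneg_AE)
qed

lemma Lp_seminorm_le_scaled:
  assumes p: "1 \<le> p" and g: "g \<in> Lp_fun M p" and f: "f \<in> borel_measurable M"
    and C: "0 \<le> C" and dom: "AE x in M. norm (f x) \<le> C * norm (g x)"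
  shows "Lp_seminorm M p f \<le> C * Lp_seminorm M p g"
proof -
  have "Lp_seminorm M p f \<le> Lp_seminorm M p (\<lambda>x. of_real C * g x)"
    using dom C by (intro Lp_seminorm_mono[OF p Lp_fun_scale[OF g] f]) (simp add: norm_mult)
  then show ?thesis
    using C by (simp add: Lp_seminorm_scale[OF p])
qed

lemma Lp_class_in_space: "f \<in> Lp_fun M p \<Longrightarrow> Lp_class M p f \<in> Lp_space M p"
  by (simp add: Lp_space_eq_image)

lemma zero_Lp_fun: "(\<lambda>x. 0) \<in> Lp_fun M p"
  by (simp add: Lp_fun_def)

text \<open>This reduces limits in the quotient space to limits of seminorms of representatives.\<close>

lemma limitin_Lp_class:
  assumes p: "1 \<le> p" and f: "\<And>n. f n \<in> Lp_fun M p" and g: "g \<in> Lp_fun M p"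
  shows "limitin (Lp_topology M p) (\<lambda>n. Lp_class M p (f n)) (Lp_class M p g) F \<longleftrightarrow>
    ((\<lambda>n. Lp_seminorm M p (\<lambda>x. f n x - g x)) \<longlongrightarrow> 0) F"
proof -
  interpret Metric_space "Lp_space M p" "Lp_dist M p"
    by (rule Metric_space_Lp[OF p])
  show ?thesis
    unfolding Lp_topology_def limitin_metric_dist_null
    using f g by (simp add: Lp_class_in_space Lp_dist_class)
qed

lemma topspace_Lp_topology: "1 \<le> p \<Longrightarrow> topspace (Lp_topology M p) = Lp_space M p"
  by (simp add: Lp_topology_def Metric_space.topspace_mtopology[OF Metric_space_Lp])


section \<open>The class of comparable functions\<close>

lemma Lp_class_comparableI:
  assumes p: "1 \<le> p" and y: "y \<in> Lp_fun M p" and z: "z \<in> borel_measurable M"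
    and c: "0 < c" "0 < C"
    and bounds: "AE x in M. c * norm (y x) \<le> norm (z x) \<and> norm (z x) \<le> C * norm (y x)"
  shows "Lp_class M p z \<in> Lp_comparable M p y"
proof -
  have "AE x in M. norm (z x) \<le> norm (of_real C * y x)"
    using bounds c by (auto simp: norm_mult)
  then have "z \<in> Lp_fun M p"
    by (rule Lp_fun_dominated[OF p Lp_fun_scale[OF y] z])
  moreover have "AE x in M. (1 / C) * norm (z x) \<le> norm (y x) \<and> norm (y x) \<le> (1 / c) * norm (z x)"
    using bounds c by (auto simp: field_simps elim!: eventually_mono)
  moreover have "0 < 1 / C" "0 < 1 / c"
    using c by auto
  ultimately show ?thesis
    unfolding Lp_comparable_def by blast
qed

lemma Lp_comparableE:
  assumes "k \<in> Lp_comparable M p y"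
  obtains z c C where "k = Lp_class M p z" "z \<in> Lp_fun M p" "0 < c" "0 < C"
    "AE x in M. c * norm (y x) \<le> norm (z x) \<and> norm (z x) \<le> C * norm (y x)"
proof -
  obtain z c1 c2 where z: "k = Lp_class M p z" "z \<in> Lp_fun M p" and c: "0 < c1" "0 < c2"
    and b: "AE x in M. c1 * norm (z x) \<le> norm (y x) \<and> norm (y x) \<le> c2 * norm (z x)"
    using assms unfolding Lp_comparable_def by blast
  have "AE x in M. (1 / c2) * norm (y x) \<le> norm (z x) \<and> norm (z x) \<le> (1 / c1) * norm (y x)"
    using b c by (auto simp: field_simps elim!: eventually_mono)
  moreover have "0 < 1 / c2" "0 < 1 / c1"
    using c by auto
  ultimately show ?thesis
    using that z by blast
qed

lemma Lp_comparable_subset_space: "Lp_comparable M p y \<subseteq> Lp_space M p"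
  by (auto simp: Lp_comparable_def Lp_class_in_space)

lemma Lp_comparable_subset_Lp_on: "Lp_comparable M p y \<subseteq> Lp_on M p {x. y x \<noteq> 0}"
proof
  fix k assume "k \<in> Lp_comparable M p y"
  then obtain z c C where z: "k = Lp_class M p z" "z \<in> Lp_fun M p"
    and b: "AE x in M. c * norm (y x) \<le> norm (z x) \<and> norm (z x) \<le> C * norm (y x)"
    by (rule Lp_comparableE)
  have "AE x in M. x \<notin> {x. y x \<noteq> 0} \<longrightarrow> z x = 0"
    using b by eventually_elim auto
  with z show "k \<in> Lp_on M p {x. y x \<noteq> 0}"
    unfolding Lp_on_def by blast
qed


section \<open>Comparable vectors have comparable orbits\<close>

lemma wtrans_iterate_Lp_fun:
  fixes M :: "'a::topological_group_add measure"
  assumes "right_Haar_measure M" "weight w" "1 \<le> p" "f \<in> Lp_fun M p"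
  shows "(wtrans a w ^^ n) f \<in> Lp_fun M p"
  by (induction n) (auto intro: wtrans_Lp_fun assms)

lemma Lp_wtrans_iterate_class:
  fixes M :: "'a::topological_group_add measure"
  assumes "right_Haar_measure M" "weight w" "1 \<le> p" "f \<in> Lp_fun M p"
  shows "(Lp_wtrans M p a w ^^ n) (Lp_class M p f) = Lp_class M p ((wtrans a w ^^ n) f)"
  by (induction n) (auto simp: Lp_wtrans_class wtrans_iterate_Lp_fun assms)

text \<open>
  Translation preserves null sets, so the inequality may be shifted by \<open>a\<close>; multiplying both sides
  by the same positive weight leaves the constant unchanged.
\<close>

lemma dominated_wtrans:
  fixes M :: "'a::topological_group_add measure"
  assumes H: "right_Haar_measure M" and w: "weight w"
    and dom: "AE x in M. norm (f x) \<le> C * norm (g x)"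
  shows "AE x in M. norm (wtrans a w f x) \<le> C * norm (wtrans a w g x)"
proof -
  have "AE x in distr M M (\<lambda>x. x - a). norm (f x) \<le> C * norm (g x)"
    unfolding distr_diff_right[OF H] by (rule dom)
  then have "AE x in M. norm (f (x - a)) \<le> C * norm (g (x - a))"
    using measurable_diff_right[OF H] by (rule AE_distrD[rotated])
  then show ?thesis
  proof eventually_elim
    case (elim x)
    have "0 < w x"
      using w by (simp add: weight_def)
    then show ?case
      using mult_left_mono[OF elim, of "w x"] by (simp add: wtrans_def norm_mult mult.left_commute)
  qed
qed

lemma dominated_wtrans_iterate:
  fixes M :: "'a::topological_group_add measure"
  assumes "right_Haar_measure M" "weight w" "AE x in M. norm (f x) \<le> C * norm (g x)"
  shows "AE x in M. norm ((wtrans a w ^^ n) f x) \<le> C * norm ((wtrans a w ^^ n) g x)"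
  by (induction n) (use assms(3) in \<open>simp_all add: dominated_wtrans[OF assms(1,2)]\<close>)

lemma Lp_seminorm_wtrans_iterate_le:
  fixes M :: "'a::topological_group_add measure"
  assumes H: "right_Haar_measure M" and w: "weight w" and p: "1 \<le> p"
    and f: "f \<in> Lp_fun M p" and g: "g \<in> Lp_fun M p"
    and C: "0 \<le> C" and dom: "AE x in M. norm (f x) \<le> C * norm (g x)"
  shows "Lp_seminorm M p ((wtrans a w ^^ n) f) \<le> C * Lp_seminorm M p ((wtrans a w ^^ n) g)"
  using wtrans_iterate_Lp_fun[OF H w p f, of n a]
  by (intro Lp_seminorm_le_scaled[OF p wtrans_iterate_Lp_fun[OF H w p g] _ C
        dominated_wtrans_iterate[OF H w dom]]) (simp add: Lp_fun_def)

lemma distributionally_irregular_class_iff: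
  fixes M :: "'a::topological_group_add measure"
  assumes H: "right_Haar_measure M" and w: "weight w" and p: "1 \<le> p" and f: "f \<in> Lp_fun M p"
  shows "distributionally_irregular M p (Lp_wtrans M p a w) (Lp_class M p f) \<longleftrightarrow>
    (\<exists>A B. A \<subseteq> {1..} \<and> B \<subseteq> {1..} \<and> upper_density A = 1 \<and> upper_density B = 1 \<and>
      ((\<lambda>n. Lp_seminorm M p ((wtrans a w ^^ n) f)) \<longlongrightarrow> 0) (inf sequentially (principal A)) \<and>
      filterlim (\<lambda>n. Lp_seminorm M p ((wtrans a w ^^ n) f)) at_top (inf sequentially (principal B)))"
  unfolding distributionally_irregular_def Lp_wtrans_iterate_class[OF assms]
  by (simp add: Lp_norm_class[OF wtrans_iterate_Lp_fun[OF assms]]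
      limitin_Lp_class[OF p wtrans_iterate_Lp_fun[OF assms] zero_Lp_fun])

lemma distributionally_irregular_comparable:
  fixes M :: "'a::topological_group_add measure"
  assumes H: "right_Haar_measure M" and w: "weight w" and p: "1 \<le> p" and y: "y \<in> Lp_fun M p"
    and irr: "distributionally_irregular M p (Lp_wtrans M p a w) (Lp_class M p y)"
    and k: "k \<in> Lp_comparable M p y"
  shows "distributionally_irregular M p (Lp_wtrans M p a w) k"
proof -
  obtain z c C where kz: "k = Lp_class M p z" and z: "z \<in> Lp_fun M p" and c: "0 < c" "0 < C"
    and b: "AE x in M. c * norm (y x) \<le> norm (z x) \<and> norm (z x) \<le> C * norm (y x)"
    using k by (rule Lp_comparableE)
  define Y where "Y n = Lp_seminorm M p ((wtrans a w ^^ n) y)" for n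
  define Z where "Z n = Lp_seminorm M p ((wtrans a w ^^ n) z)" for n
  have ZC: "Z n \<le> C * Y n" for n
    unfolding Z_def Y_def using c b by (intro Lp_seminorm_wtrans_iterate_le[OF H w p z y]) auto
  have YZ: "Y n \<le> (1 / c) * Z n" for n
    unfolding Z_def Y_def using c b
    by (intro Lp_seminorm_wtrans_iterate_le[OF H w p y z])
      (auto simp: field_simps elim!: eventually_mono)
  then have cY: "c * Y n \<le> Z n" for n
    using YZ[of n] c by (simp add: field_simps)
  obtain A B where AB: "A \<subseteq> {1..}" "B \<subseteq> {1..}" "upper_density A = 1" "upper_density B = 1"
    and YA: "(Y \<longlongrightarrow> 0) (inf sequentially (principal A))"
    and YB: "filterlim Y at_top (inf sequentially (principal B))"
    using irr unfolding distributionally_irregular_class_iff[OF H w p y] Y_def by blast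
  have "((\<lambda>n. C * Y n) \<longlongrightarrow> 0) (inf sequentially (principal A))"
    using tendsto_mult_left[OF YA, of C] by simp
  then have "(Z \<longlongrightarrow> 0) (inf sequentially (principal A))"
    by (rule tendsto_sandwich[OF _ _ tendsto_const, rotated -1])
      (simp_all add: ZC, simp add: Z_def Lp_seminorm_nonneg)
  moreover have "filterlim (\<lambda>n. c * Y n) at_top (inf sequentially (principal B))"
    using c YB by (intro filterlim_tendsto_pos_mult_at_top[OF tendsto_const])
  then have "filterlim Z at_top (inf sequentially (principal B))"
    by (rule filterlim_at_top_mono) (simp add: cY)
  ultimately show ?thesis
    unfolding kz distributionally_irregular_class_iff[OF H w p z] using AB unfolding Z_def by blast
qed


section \<open>Path connectedness\<close>

text \<open>
  Since the cross term in the expansion of the square is nonnegative, the square is at least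
  \<open>((1 - t)\<^sup>2 + t\<^sup>2) d\<^sup>2\<close>, and one of \<open>1 - t\<close> and \<open>t\<close> is at least a half.
\<close>

lemma norm_segment_ge:
  fixes u v :: "'a::real_inner"
  assumes t: "0 \<le> t" "t \<le> 1" and uv: "0 \<le> u \<bullet> v" and d: "0 \<le> d" "d \<le> norm u" "d \<le> norm v"
  shows "d / 2 \<le> norm ((1 - t) *\<^sub>R u + t *\<^sub>R v)"
proof -
  have half: "(1 / 2)\<^sup>2 \<le> (1 - t)\<^sup>2 + t\<^sup>2"
    using zero_le_power2[of "2 * t - 1"] by (simp add: power2_eq_square algebra_simps)
  have "(d / 2)\<^sup>2 = (1 / 2)\<^sup>2 * d\<^sup>2"
    by (simp add: power2_eq_square)
  also have "\<dots> \<le> ((1 - t)\<^sup>2 + t\<^sup>2) * d\<^sup>2"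
    using half by (intro mult_right_mono) auto
  also have "\<dots> \<le> (1 - t)\<^sup>2 * (norm u)\<^sup>2 + t\<^sup>2 * (norm v)\<^sup>2"
    unfolding distrib_right using d by (intro add_mono mult_left_mono power_mono) auto
  also have "\<dots> \<le> (1 - t)\<^sup>2 * (norm u)\<^sup>2 + t\<^sup>2 * (norm v)\<^sup>2 + 2 * ((1 - t) * t) * (u \<bullet> v)"
    using t uv by simp
  also have "\<dots> = (norm ((1 - t) *\<^sub>R u + t *\<^sub>R v))\<^sup>2"
    unfolding power2_norm_eq_inner
    by (simp add: inner_add_left inner_add_right inner_commute power2_eq_square algebra_simps)
  finally show ?thesis
    by (rule power2_le_imp_le) simp
qed

text \<open>The parametrised segment is Lipschitz, with the distance between its endpoints as constant.\<close>

lemma pathin_Lp_segment: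
  fixes u v :: "'a \<Rightarrow> complex"
  assumes p: "1 \<le> p" and u: "u \<in> Lp_fun M p" and v: "v \<in> Lp_fun M p"
  shows "pathin (Lp_topology M p) (\<lambda>t. Lp_class M p (\<lambda>x. (1 - t) *\<^sub>R u x + t *\<^sub>R v x))"
proof -
  interpret Metric_space "Lp_space M p" "Lp_dist M p"
    by (rule Metric_space_Lp[OF p])
  define g where "g t = (\<lambda>x. (1 - t) *\<^sub>R u x + t *\<^sub>R v x)" for t :: real
  define D where "D = Lp_seminorm M p (\<lambda>x. v x - u x)"
  have g: "g t \<in> Lp_fun M p" for t
    unfolding g_def scaleR_conv_of_real
    by (intro Lp_minkowski(1)[OF p] Lp_fun_scale u v)
  have dist: "Lp_dist M p (Lp_class M p (g s)) (Lp_class M p (g t)) = \<bar>s - t\<bar> * D" for s t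
  proof -
    have "(\<lambda>x. g s x - g t x) = (\<lambda>x. of_real (s - t) * (v x - u x))"
      by (rule ext) (simp add: g_def scaleR_conv_of_real algebra_simps)
    then show ?thesis
      by (simp add: Lp_dist_class[OF g g] Lp_seminorm_scale[OF p] D_def del: of_real_diff)
  qed
  have D: "0 \<le> D"
    by (simp add: D_def Lp_seminorm_nonneg)
  have "continuous_map (top_of_set {0..1}) mtopology (\<lambda>t. Lp_class M p (g t))"
    unfolding continuous_map_to_metric
  proof (intro ballI allI impI)
    fix t e :: real
    assume t: "t \<in> topspace (top_of_set {0..1})" and e: "0 < e"
    \<comment> \<open>The \<open>+ 1\<close> allows for coinciding endpoints, where \<open>D\<close> is \<open>0\<close>.\<close>
    let ?U = "{0..1} \<inter> ball t (e / (D + 1))"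
    have "Lp_class M p (g s) \<in> mball (Lp_class M p (g t)) e" if "s \<in> ?U" for s
    proof -
      have "\<bar>t - s\<bar> * (D + 1) < e"
        using that D by (simp add: dist_real_def pos_less_divide_eq)
      moreover have "\<bar>t - s\<bar> * D \<le> \<bar>t - s\<bar> * (D + 1)"
        by (intro mult_left_mono) auto
      ultimately show ?thesis
        by (simp add: in_mball dist g Lp_class_in_space)
    qed
    moreover have "openin (top_of_set {0..1}) ?U"
      by (intro openin_open_Int) simp
    moreover have "t \<in> ?U"
      using t e D by simp
    ultimately show "\<exists>U. openin (top_of_set {0..1}) U \<and> t \<in> U \<and>
        (\<forall>s\<in>U. Lp_class M p (g s) \<in> mball (Lp_class M p (g t)) e)"
      by blast
  qed
  then show ?thesis
    by (simp add: pathin_def Lp_topology_def g_def)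
qed

lemma path_component_of_Lp_segment:
  fixes u v :: "'a \<Rightarrow> complex"
  assumes p: "1 \<le> p" and y: "y \<in> Lp_fun M p" and u: "u \<in> Lp_fun M p" and v: "v \<in> Lp_fun M p"
    and c: "0 < c" "0 < C"
    and bu: "AE x in M. c * norm (y x) \<le> norm (u x) \<and> norm (u x) \<le> C * norm (y x)"
    and bv: "AE x in M. c * norm (y x) \<le> norm (v x) \<and> norm (v x) \<le> C * norm (y x)"
    and uv: "AE x in M. 0 \<le> u x \<bullet> v x"
  shows "path_component_of (subtopology (Lp_topology M p) (Lp_comparable M p y))
    (Lp_class M p u) (Lp_class M p v)"
proof -
  have in_comp: "Lp_class M p (\<lambda>x. (1 - t) *\<^sub>R u x + t *\<^sub>R v x) \<in> Lp_comparable M p y"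
    if t: "0 \<le> t" "t \<le> 1" for t
  proof (rule Lp_class_comparableI[OF p y])
    have [measurable]: "u \<in> borel_measurable M" "v \<in> borel_measurable M"
      using u v by (auto simp: Lp_fun_def)
    show "(\<lambda>x. (1 - t) *\<^sub>R u x + t *\<^sub>R v x) \<in> borel_measurable M"
      by measurable
    show "0 < c / 2" "0 < C"
      using c by auto
    show "AE x in M. c / 2 * norm (y x) \<le> norm ((1 - t) *\<^sub>R u x + t *\<^sub>R v x) \<and>
        norm ((1 - t) *\<^sub>R u x + t *\<^sub>R v x) \<le> C * norm (y x)"
      using bu bv uv
    proof eventually_elim
      case (elim x)
      have "norm ((1 - t) *\<^sub>R u x + t *\<^sub>R v x) \<le> (1 - t) * norm (u x) + t * norm (v x)"
        using t by (intro norm_triangle_le) simp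
      also have "\<dots> \<le> C * norm (y x)"
        using elim t by (intro convex_bound_le) auto
      finally show ?case
        using norm_segment_ge[OF t, of "u x" "v x" "c * norm (y x)"] elim c by simp
    qed
  qed
  show ?thesis
    unfolding path_component_of_def pathin_subtopology
    by (rule exI[of _ "\<lambda>t. Lp_class M p (\<lambda>x. (1 - t) *\<^sub>R u x + t *\<^sub>R v x)"])
      (auto simp: in_comp pathin_Lp_segment[OF p u v])
qed

lemma path_connectedin_Lp_comparable:
  assumes p: "1 \<le> p" and y: "y \<in> Lp_fun M p"
  shows "path_connectedin (Lp_topology M p) (Lp_comparable M p y)"
proof -
  let ?X = "subtopology (Lp_topology M p) (Lp_comparable M p y)"
  let ?m = "\<lambda>x. complex_of_real (norm (y x))"
  have y_meas [measurable]: "y \<in> borel_measurable M"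
    using y by (simp add: Lp_fun_def)
  have to_modulus: "path_component_of ?X k (Lp_class M p ?m)"
    if k: "k \<in> Lp_comparable M p y" for k
  proof -
    obtain z c C where kz: "k = Lp_class M p z" and z: "z \<in> Lp_fun M p" and c: "0 < c" "0 < C"
      and b: "AE x in M. c * norm (y x) \<le> norm (z x) \<and> norm (z x) \<le> C * norm (y x)"
      using k by (rule Lp_comparableE)
    have [measurable]: "z \<in> borel_measurable M"
      using z by (simp add: Lp_fun_def)
    define v where "v x = (if 0 \<le> Im (z x) then \<i> else - \<i>) * ?m x" for x
    have nv: "norm (v x) = norm (y x)" for x
      by (simp add: v_def norm_mult)
    have "v \<in> borel_measurable M"
      unfolding v_def by measurable
    then have v: "v \<in> Lp_fun M p"
      by (rule Lp_fun_dominated[OF p y]) (simp add: nv)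
    \<comment> \<open>One pair of constants has to serve both endpoints, and \<open>v\<close> needs a pair enclosing \<open>1\<close>.\<close>
    have "AE x in M. min c 1 * norm (y x) \<le> norm (z x) \<and> norm (z x) \<le> max C 1 * norm (y x)"
      using b
    proof eventually_elim
      case (elim x)
      have "min c 1 * norm (y x) \<le> c * norm (y x)" "C * norm (y x) \<le> max C 1 * norm (y x)"
        by (auto intro: mult_right_mono)
      with elim show ?case
        by linarith
    qed
    moreover have "min c 1 * norm (y x) \<le> norm (v x)" "norm (v x) \<le> max C 1 * norm (y x)" for x
      using mult_right_mono[of "min c 1" 1 "norm (y x)"] mult_right_mono[of 1 "max C 1" "norm (y x)"]
      by (auto simp: nv)
    moreover have "0 \<le> z x \<bullet> v x" for x
      by (simp add: v_def inner_complex_def mult_nonpos_nonneg)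
    ultimately have "path_component_of ?X k (Lp_class M p v)"
      unfolding kz using c by (intro path_component_of_Lp_segment[OF p y z v, of "min c 1" "max C 1"]) auto
    moreover have "path_component_of ?X (Lp_class M p v) (Lp_class M p ?m)"
      by (rule path_component_of_Lp_segment[OF p y v Lp_fun_norm[OF y], of 1 1])
        (simp_all add: nv, simp add: v_def inner_complex_def)
    ultimately show ?thesis
      by (rule path_component_of_trans)
  qed
  have "path_connected_space ?X"
    unfolding path_connected_space_iff_path_component
    using to_modulus by (auto intro: path_component_of_trans path_component_of_sym)
  then show ?thesis
    using Lp_comparable_subset_space[of M p y] p
    by (simp add: path_connectedin_def topspace_Lp_topology)
qed


section \<open>Density\<close>

text \<open>
  If \<open>f\<close> lies in the closure and \<open>h\<close> vanishes outside \<open>Y\<close>, the part of \<open>f\<close> outside \<open>Y\<close> coincides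
  there with \<open>f - h\<close>, so its seminorm is at most the distance from \<open>f\<close> to \<open>h\<close>, which is as small as
  desired.
\<close>

lemma closedin_Lp_on:
  assumes p: "1 \<le> p" and Y: "{x \<in> space M. x \<in> Y} \<in> sets M"
  shows "closedin (Lp_topology M p) (Lp_on M p Y)"
proof -
  interpret Metric_space "Lp_space M p" "Lp_dist M p"
    by (rule Metric_space_Lp[OF p])
  have sub: "Lp_on M p Y \<subseteq> Lp_space M p"
    by (auto simp: Lp_on_def Lp_class_in_space)
  have "k \<in> Lp_on M p Y" if k: "k \<in> mtopology closure_of Lp_on M p Y" for k
  proof -
    have "k \<in> Lp_space M p"
      using k by (simp add: metric_closure_of)
    then obtain f where f: "f \<in> Lp_fun M p" and kf: "k = Lp_class M p f"
      by (auto simp: Lp_space_eq_image)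
    have [measurable]: "f \<in> borel_measurable M" "Measurable.pred M (\<lambda>x. x \<in> Y)"
      using f Y by (simp_all add: Lp_fun_def pred_def)
    define q where "q x = (if x \<in> Y then 0 else f x)" for x
    have q_meas: "q \<in> borel_measurable M"
      unfolding q_def by measurable
    have q: "q \<in> Lp_fun M p"
      by (rule Lp_fun_dominated[OF p f q_meas]) (simp add: q_def)
    have "Lp_seminorm M p q < e" if e: "0 < e" for e
    proof -
      obtain h where h: "h \<in> Lp_fun M p" and h0: "AE x in M. x \<notin> Y \<longrightarrow> h x = 0"
        and d: "Lp_dist M p k (Lp_class M p h) < e"
        using k e unfolding metric_closure_of Lp_on_def by (auto simp: in_mball)
      have "Lp_seminorm M p q \<le> Lp_seminorm M p (\<lambda>x. f x - h x)"
        using h0 by (intro Lp_seminorm_mono[OF p Lp_fun_diff[OF p f h] q_meas])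
          (auto simp: q_def elim!: eventually_mono)
      also have "\<dots> < e"
        using d by (simp add: kf Lp_dist_class[OF f h])
      finally show ?thesis .
    qed
    then have "Lp_seminorm M p q = 0"
      using Lp_seminorm_nonneg[of M p q] by (metis less_irrefl order_le_less)
    then have "AE x in M. q x = 0"
      by (simp add: Lp_seminorm_eq_0_iff[OF p q])
    then have "AE x in M. x \<notin> Y \<longrightarrow> f x = 0"
      by eventually_elim (simp add: q_def split: if_splits)
    with f kf show ?thesis
      unfolding Lp_on_def by blast
  qed
  then have "mtopology closure_of Lp_on M p Y \<subseteq> Lp_on M p Y"
    by blast
  then show ?thesis
    using sub by (simp add: Lp_topology_def closure_of_subset_eq[symmetric])
qed

lemma Lp_seminorm_dominated_convergence:
  fixes f :: "nat \<Rightarrow> 'a \<Rightarrow> complex"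
  assumes p: "1 \<le> p" and g: "g \<in> Lp_fun M p"
    and f [measurable]: "\<And>n. f n \<in> borel_measurable M"
    and dom: "\<And>n. AE x in M. norm (f n x) \<le> norm (g x)"
    and lim: "AE x in M. (\<lambda>n. f n x) \<longlonglongrightarrow> 0"
  shows "(\<lambda>n. Lp_seminorm M p (f n)) \<longlonglongrightarrow> 0"
proof -
  have "(\<lambda>n. LINT x|M. norm (f n x) powr p) \<longlonglongrightarrow> (LINT x|M. 0)"
  proof (rule integral_dominated_convergence)
    show "integrable M (\<lambda>x. norm (g x) powr p)"
      using g by (simp add: Lp_fun_def)
    show "AE x in M. (\<lambda>n. norm (f n x) powr p) \<longlonglongrightarrow> 0"
      using lim
    proof eventually_elim
      case (elim x)
      then show ?case
        using p by (intro tendsto_zero_powrI[OF tendsto_norm_zero tendsto_const]) auto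
    qed
    show "AE x in M. norm (norm (f n x) powr p) \<le> norm (g x) powr p" for n
      using dom[of n] p by (auto elim!: eventually_mono intro: powr_mono2)
  qed auto
  then show ?thesis
    unfolding Lp_seminorm_def using p
    by (intro tendsto_zero_powrI[OF _ tendsto_const]) (auto intro: integral_nonneg_AE)
qed

text \<open>
  The two-sided condition on \<open>|f|\<close> is what puts each approximant into \<open>[y]\<close>.  At a fixed point where
  \<open>f\<close> and \<open>y\<close> are both nonzero the condition eventually holds, so the error is eventually \<open>0\<close>; where only
  \<open>f\<close> vanishes the error is the replacement value itself, which tends to \<open>0\<close>.
\<close>

lemma Lp_on_subset_closure_comparable:
  assumes p: "1 \<le> p" and y: "y \<in> Lp_fun M p"
  shows "Lp_on M p {x. y x \<noteq> 0} \<subseteq> Lp_topology M p closure_of Lp_comparable M p y"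
proof
  fix k assume "k \<in> Lp_on M p {x. y x \<noteq> 0}"
  then obtain f where kf: "k = Lp_class M p f" and f: "f \<in> Lp_fun M p"
    and f0: "AE x in M. y x = 0 \<longrightarrow> f x = 0"
    by (auto simp: Lp_on_def)
  have [measurable]: "y \<in> borel_measurable M" "f \<in> borel_measurable M"
    using y f by (simp_all add: Lp_fun_def)
  define r where "r n = real (Suc n)" for n
  have r: "1 \<le> r n" for n
    by (simp add: r_def)
  define g where "g n x = (if norm (y x) / r n \<le> norm (f x) \<and> norm (f x) \<le> r n * norm (y x)
      then f x else of_real (1 / r n) * y x)" for n x
  have g_meas [measurable]: "g n \<in> borel_measurable M" for n
    unfolding g_def by measurable
  have small: "norm (of_real (1 / r n) * y x) \<le> norm (y x)" for n x
    using r[of n] mult_right_mono[of 1 "r n" "norm (y x)"] by (simp add: norm_mult norm_divide field_simps)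
  have bounds: "1 / r n * norm (y x) \<le> norm (g n x) \<and> norm (g n x) \<le> r n * norm (y x)" for n x
  proof -
    have "norm (y x) \<le> r n * norm (y x)"
      using r[of n] mult_right_mono[of 1 "r n" "norm (y x)"] by simp
    then show ?thesis
      using small[of n x] r[of n] by (auto simp: g_def norm_mult norm_divide)
  qed
  have comp: "Lp_class M p (g n) \<in> Lp_comparable M p y" for n
    using bounds[of n] r[of n]
    by (intro Lp_class_comparableI[OF p y g_meas, of "1 / r n" "r n"]) auto
  have g: "g n \<in> Lp_fun M p" for n
    using bounds[of n] r[of n]
    by (intro Lp_fun_dominated[OF p Lp_fun_scale[OF y, of "r n"] g_meas]) (auto simp: norm_mult)
  have "(\<lambda>n. Lp_seminorm M p (\<lambda>x. g n x - f x)) \<longlonglongrightarrow> 0"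
  proof (rule Lp_seminorm_dominated_convergence[OF p])
    show "(\<lambda>x. complex_of_real (norm (f x)) + of_real (norm (y x))) \<in> Lp_fun M p"
      by (intro Lp_minkowski(1)[OF p] Lp_fun_norm f y)
    have "norm (g n x - f x) \<le> norm (f x) + norm (y x)" for n x
      using small[of n x] norm_triangle_ineq4[of "of_real (1 / r n) * y x" "f x"] by (simp add: g_def)
    then show "AE x in M. norm (g n x - f x)
        \<le> norm (complex_of_real (norm (f x)) + of_real (norm (y x)))" for n
      by (simp flip: of_real_add)
    show "AE x in M. (\<lambda>n. g n x - f x) \<longlonglongrightarrow> 0"
      using f0
    proof eventually_elim
      case (elim x)
      consider "y x = 0" "f x = 0" | "y x \<noteq> 0" "f x = 0" | "y x \<noteq> 0" "f x \<noteq> 0"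
        using elim by blast
      then show ?case
      proof cases
        case 1
        then show ?thesis
          by (simp add: g_def)
      next
        case 2
        have "0 < norm (y x) / r n" for n
          using 2 r[of n] by simp
        then have "g n x - f x = of_real (1 / r n) * y x" for n
          using 2 by (simp add: g_def flip: not_less)
        moreover have "(\<lambda>n. 1 / r n) \<longlonglongrightarrow> 0"
          unfolding r_def using LIMSEQ_inverse_real_of_nat by (simp add: inverse_eq_divide)
        then have "(\<lambda>n. of_real (1 / r n) * y x) \<longlonglongrightarrow> of_real 0 * y x"
          by (intro tendsto_intros)
        ultimately show ?thesis
          by simp
      next
        case 3
        have top: "filterlim r at_top sequentially"
          unfolding r_def by (rule filterlim_compose[OF filterlim_real_sequentially filterlim_Suc])
        have "\<forall>\<^sub>F n in sequentially. g n x - f x = 0"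
          using filterlim_at_top[THEN iffD1, OF top, rule_format, of "norm (y x) / norm (f x)"]
            filterlim_at_top[THEN iffD1, OF top, rule_format, of "norm (f x) / norm (y x)"]
        proof eventually_elim
          case (elim n)
          then have "norm (y x) / r n \<le> norm (f x)" "norm (f x) \<le> r n * norm (y x)"
            using 3 r[of n] by (simp_all add: field_simps)
          then show ?case
            by (simp add: g_def)
        qed
        then show ?thesis
          by (rule tendsto_eventually)
      qed
    qed
  qed simp
  then have "limitin (Lp_topology M p) (\<lambda>n. Lp_class M p (g n)) k sequentially"
    unfolding kf by (simp add: limitin_Lp_class[OF p g f])
  moreover have "Lp_comparable M p y \<subseteq> Lp_topology M p closure_of Lp_comparable M p y"
    using Lp_comparable_subset_space by (intro closure_of_subset) (simp add: topspace_Lp_topology[OF p])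
  then have "Lp_class M p (g n) \<in> Lp_topology M p closure_of Lp_comparable M p y" for n
    using comp by blast
  ultimately show "k \<in> Lp_topology M p closure_of Lp_comparable M p y"
    by (rule limitin_closedin[OF _ closedin_closure_of always_eventually[OF allI]]) simp
qed

lemma closure_of_Lp_comparable:
  assumes p: "1 \<le> p" and y: "y \<in> Lp_fun M p"
  shows "Lp_topology M p closure_of Lp_comparable M p y = Lp_on M p {x. y x \<noteq> 0}"
proof
  have [measurable]: "y \<in> borel_measurable M"
    using y by (simp add: Lp_fun_def)
  have "{x \<in> space M. x \<in> {x. y x \<noteq> 0}} \<in> sets M"
    by simp
  from closedin_Lp_on[OF p this]
  show "Lp_topology M p closure_of Lp_comparable M p y \<subseteq> Lp_on M p {x. y x \<noteq> 0}"
    by (rule closure_of_minimal[OF Lp_comparable_subset_Lp_on])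
qed (rule Lp_on_subset_closure_comparable[OF assms])


section \<open>The set of irregular vectors\<close>

theorem theorem3p7:
  fixes M :: "'a::{topological_group_add, second_countable_topology, t2_space} measure"
    and p :: real and a :: 'a and w :: "'a \<Rightarrow> real" and y :: "'a \<Rightarrow> complex"
  assumes "locally_compact_space (euclidean :: 'a topology)"
    and "right_Haar_measure M"
    and "1 \<le> p"
    and "weight w"
    and "y \<in> Lp_fun M p"
    and "distributionally_irregular M p (Lp_wtrans M p a w) (Lp_class M p y)"
  shows "Lp_comparable M p y \<subseteq> DIV M p a w
    \<and> path_connectedin (Lp_topology M p) (Lp_comparable M p y)
    \<and> Lp_topology M p closure_of Lp_comparable M p y = Lp_on M p {x. y x \<noteq> 0}
    \<and> connectedin (Lp_topology M p) (DIV M p a w \<inter> Lp_on M p {x. y x \<noteq> 0})"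
proof -
  have div: "Lp_comparable M p y \<subseteq> DIV M p a w"
    using distributionally_irregular_comparable[OF assms(2,4,3,5,6)] Lp_comparable_subset_space
    unfolding DIV_def by blast
  note path = path_connectedin_Lp_comparable[OF assms(3,5)]
  note closure = closure_of_Lp_comparable[OF assms(3,5)]
  have "connectedin (Lp_topology M p) (DIV M p a w \<inter> Lp_on M p {x. y x \<noteq> 0})"
    using div Lp_comparable_subset_Lp_on[of M p y] closure
    by (intro connectedin_intermediate_closure_of[OF path_connectedin_imp_connectedin[OF path]]) auto
  with div path closure show ?thesis
    by blast
qed

end
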